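(* Let $n\in\mathbb{N}$, let $\lambda$ be a partition with $\ell(\lambda)\le 2n$, let $\mu,\nu\subseteq\lambda$ be partitions with $\ell(\mu)\le n$ and $\nu$ even, and let $T\in LR(\lambda/\mu,\nu)$ be a Littlewood-Richardson tableau on the alphabet $[2n]$, with left companion $G_\mu(T)\in SST_{2n}(\mu)$. Then $T$ does not satisfy the Sundaram property if and only if $G_\mu(T)$ is not symplectic. Moreover, in this case, there exists a unique $t\ge 0$ such that: (1) $n+t+1$ is the minimal row number of $T$ where a Sundaram property violation occurs; (2) $T(n+t,1)=2t$, $T(n+t+1,1)=2t+1$, $T(n+t+2,1)=2(t+1)$, and $T(n+k,1)\ge 2k$ for all $1\le k\le t-1$; (3) the maximal row of $G_\mu(T)$ where a symplectic violation occurs is among the rows of the bottom-most $t+1$ cells $(\ell(\mu),1),(\ell(\mu)-1,1),\dots,(\ell(\mu)-t,1)$ of the first column of $G_\mu(T)$.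
   Context: Partitions are identified with Young diagrams $D(\cdot)$ (matrix coordinates $(i,j)$, row $i$ from the top, column $j$); $\ell(\gamma)$ is the number of nonzero parts. A partition $\nu$ is even if $\nu_{2i-1}=\nu_{2i}$ for all $i\ge 1$. $[m]=\{1,\dots,m\}$. A semistandard tableau $T$ of shape $\lambda/\mu$ on $[2n]$ is a filling of $D(\lambda)$ with $T(i,j)=0$ for $(i,j)\in D(\mu)$, entries in $[2n]$ on $D(\lambda)\setminus D(\mu)$, weakly increasing along rows (left to right) and, on $D(\lambda)\setminus D(\mu)$, strictly increasing down columns; by convention $T(a,b)=\infty$ if $(a,b)\notin D(\lambda)$. $SST_{2n}(\mu)$ is the set of semistandard tableaux of straight shape $\mu$ with entries in $[2n]$. The weight of $T$ is the vector whose $i$th entry is the number of $i$'s in $T$. The reverse row word of $T$ reads the nonzero entries of each row right to left, rows from top to bottom. A word is Yamanouchi if every prefix has weight a partition. $LR(\lambda/\mu,\nu)$ is the set of semistandard tableaux of shape $\lambda/\mu$ on $[2n]$ of weight $\nu$ whose reverse row word is Yamanouchi. Left companion: for $T\in LR(\lambda/\mu,\nu)$ and $r=1,\dots,2n$, let $\mu^{(2n-r+1)}$ be the partition giving the shape occupied by the entries $<r$ (including the entries $0$ in the cells of $\mu$) in rows $r,r+1,\dots,2n$ of $T$; i.e. $\mu^{(2n-r+1)}_j$ is the number of cells in row $r+j-1$ of $T$ with entry $<r$, $1\le j\le 2n-r+1$. The nested sequence $\mu=\mu^{(2n)}\supseteq\mu^{(2n-1)}\supseteq\cdots\supseteq\mu^{(1)}$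 is a Gelfand-Tsetlin pattern and defines $G_\mu(T)\in SST_{2n}(\mu)$: the cells of $G_\mu(T)$ with entry $\le i$ are exactly the cells of $\mu^{(i)}$. Sundaram property: $T\in LR(\lambda/\mu,\nu)$ satisfies it if whenever $T(k,j)=2i+1$ for some cell $(k,j)$ and integer $i\ge 0$, then $k\le n+i$. A Sundaram property violation occurs in row $k$ if $T(k,j)=2i+1$ for some $j$ and some $i\ge 0$ with $k>n+i$. Symplectic: $G\in SST_{2n}(\mu)$ is symplectic if $G(k,1)\ge 2k-1$ for all $k\in[\ell(\mu)]$. A symplectic violation occurs in row $k$ of $G$ (in cell $(k,1)$) if $G(k,1)<2k-1$. *)

theory Defs
  imports Main "HOL-Library.Extended_Nat" "HOL-Library.Sublist"
begin

text \<open>Rows, columns and parts are indexed from 1: the value of a partition at index 0 is ignored.\<close>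

definition is_partition :: "(nat \<Rightarrow> nat) \<Rightarrow> bool" where
  "is_partition p \<longleftrightarrow> (\<forall>i\<ge>1. p (Suc i) \<le> p i) \<and> finite {i. 1 \<le> i \<and> p i \<noteq> 0}"

definition len :: "(nat \<Rightarrow> nat) \<Rightarrow> nat" where
  "len p = card {i. 1 \<le> i \<and> p i \<noteq> 0}"

definition even_partition :: "(nat \<Rightarrow> nat) \<Rightarrow> bool" where
  "even_partition p \<longleftrightarrow> is_partition p \<and> (\<forall>i\<ge>1. p (2 * i - 1) = p (2 * i))"

definition diagram :: "(nat \<Rightarrow> nat) \<Rightarrow> (nat \<times> nat) set" where
  "diagram p = {(i, j). 1 \<le> i \<and> 1 \<le> j \<and> j \<le> p i}"

text \<open>Tableaux are total functions: 0 on the inner shape and \<open>\<infinity>\<close> outside the outer shape.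
  Rows increase weakly on the whole outer diagram; columns increase strictly on the skew part only.\<close>

definition SSYT :: "nat \<Rightarrow> (nat \<Rightarrow> nat) \<Rightarrow> (nat \<Rightarrow> nat) \<Rightarrow> (nat \<Rightarrow> nat \<Rightarrow> enat) set" where
  "SSYT m lam mu = {T.
     (\<forall>(i, j) \<in> diagram mu. T i j = 0) \<and>
     (\<forall>(i, j) \<in> diagram lam - diagram mu. T i j \<in> enat ` {1..m}) \<and>
     (\<forall>i j. (i, j) \<notin> diagram lam \<longrightarrow> T i j = \<infinity>) \<and>
     (\<forall>i j. (i, j) \<in> diagram lam \<and> (i, Suc j) \<in> diagram lam \<longrightarrow> T i j \<le> T i (Suc j)) \<and>
     (\<forall>i j. (i, j) \<in> diagram lam - diagram mu \<and> (Suc i, j) \<in> diagram lam - diagram mu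
        \<longrightarrow> T i j < T (Suc i) j)}"

definition SST :: "nat \<Rightarrow> (nat \<Rightarrow> nat) \<Rightarrow> (nat \<Rightarrow> nat \<Rightarrow> enat) set" where
  "SST m mu = SSYT m mu (\<lambda>_. 0)"

definition weight :: "(nat \<Rightarrow> nat \<Rightarrow> enat) \<Rightarrow> nat \<Rightarrow> nat" where
  "weight T i = card {(a, b). T a b = enat i}"

definition reverse_row_word :: "(nat \<Rightarrow> nat) \<Rightarrow> (nat \<Rightarrow> nat \<Rightarrow> enat) \<Rightarrow> nat list" where
  "reverse_row_word lam T =
     concat (map (\<lambda>i. map (\<lambda>j. the_enat (T i j))
                        (filter (\<lambda>j. T i j \<noteq> 0) (rev [1..<Suc (lam i)])))
              [1..<Suc (len lam)])"

definition yamanouchi :: "nat list \<Rightarrow> bool" where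
  "yamanouchi w \<longleftrightarrow> (\<forall>u. prefix u w \<longrightarrow> is_partition (count_list u))"

definition LR :: "nat \<Rightarrow> (nat \<Rightarrow> nat) \<Rightarrow> (nat \<Rightarrow> nat) \<Rightarrow> (nat \<Rightarrow> nat)
    \<Rightarrow> (nat \<Rightarrow> nat \<Rightarrow> enat) set" where
  "LR n lam mu nu = {T \<in> SSYT (2 * n) lam mu.
     (\<forall>i\<ge>1. weight T i = nu i) \<and> yamanouchi (reverse_row_word lam T)}"

text \<open>The partition \<open>\<mu>\<^sup>(\<^sup>i\<^sup>)\<close>, with \<open>r = 2n - i + 1\<close>.\<close>

definition companion_shape :: "nat \<Rightarrow> (nat \<Rightarrow> nat \<Rightarrow> enat) \<Rightarrow> nat \<Rightarrow> nat \<Rightarrow> nat" where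
  "companion_shape n T i j =
     (let r = 2 * n - i + 1
      in if 1 \<le> j \<and> j \<le> i then card {c. T (r + j - 1) c < enat r} else 0)"

definition left_companion :: "nat \<Rightarrow> (nat \<Rightarrow> nat) \<Rightarrow> (nat \<Rightarrow> nat \<Rightarrow> enat) \<Rightarrow> nat \<Rightarrow> nat \<Rightarrow> enat" where
  "left_companion n mu T a b =
     (if (a, b) \<in> diagram mu
      then enat (LEAST i. (a, b) \<in> diagram (companion_shape n T i))
      else \<infinity>)"

definition sundaram_property :: "nat \<Rightarrow> (nat \<Rightarrow> nat \<Rightarrow> enat) \<Rightarrow> bool" where
  "sundaram_property n T \<longleftrightarrow> (\<forall>k j i. T k j = enat (2 * i + 1) \<longrightarrow> k \<le> n + i)"

definition sundaram_violation :: "nat \<Rightarrow> (nat \<Rightarrow> nat \<Rightarrow> enat) \<Rightarrow> nat \<Rightarrow> bool" where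
  "sundaram_violation n T k \<longleftrightarrow> (\<exists>j i. T k j = enat (2 * i + 1) \<and> n + i < k)"

definition symplectic :: "(nat \<Rightarrow> nat) \<Rightarrow> (nat \<Rightarrow> nat \<Rightarrow> enat) \<Rightarrow> bool" where
  "symplectic mu G \<longleftrightarrow> (\<forall>k \<in> {1..len mu}. enat (2 * k - 1) \<le> G k 1)"

definition symplectic_violation :: "(nat \<Rightarrow> nat) \<Rightarrow> (nat \<Rightarrow> nat \<Rightarrow> enat) \<Rightarrow> nat \<Rightarrow> bool" where
  "symplectic_violation mu G k \<longleftrightarrow> k \<in> {1..len mu} \<and> G k 1 < enat (2 * k - 1)"


text \<open>The left companion is well defined: it is a semistandard tableau of shape \<open>\<mu>\<close>, and its
  cells with entry at most \<open>i\<close> are exactly those of \<open>\<mu>\<^sup>(\<^sup>i\<^sup>)\<close>.\<close>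

lemma partition_antimono:
  assumes "is_partition p" "1 \<le> i" "i \<le> i'"
  shows "p i' \<le> p i"
  using assms(3,2)
proof (induction i' rule: dec_induct)
  case (step k)
  then show ?case using assms(1) unfolding is_partition_def
    by (metis le_trans)
qed simp

lemma partition_len:
  assumes "is_partition p" "1 \<le> i" "p i \<noteq> 0"
  shows "i \<le> len p"
proof -
  have "{1..i} \<subseteq> {i. 1 \<le> i \<and> p i \<noteq> 0}"
  proof
    fix k assume "k \<in> {1..i}"
    then show "k \<in> {i. 1 \<le> i \<and> p i \<noteq> 0}"
      using partition_antimono[OF assms(1), of k i] assms(3) by auto
  qed
  then have "card {1..i} \<le> len p"
    using assms(1) unfolding len_def is_partition_def by (intro card_mono) auto
  then show ?thesis by simp
qed

lemma diagram_up:
  assumes "is_partition p" "(Suc a, b) \<in> diagram p" "1 \<le> a"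
  shows "(a, b) \<in> diagram p"
proof -
  have "p (Suc a) \<le> p a" using assms(1,3) by (simp add: is_partition_def)
  then show ?thesis using assms(2,3) by (auto simp: diagram_def)
qed

context
  fixes n :: nat and lam mu :: "nat \<Rightarrow> nat" and T :: "nat \<Rightarrow> nat \<Rightarrow> enat"
  assumes lam: "is_partition lam" and mu: "is_partition mu" and lmu: "len mu \<le> 2 * n"
    and T: "T \<in> SSYT (2 * n) lam mu"
begin

lemma T_mu: "(i, j) \<in> diagram mu \<Longrightarrow> T i j = 0"
  using T unfolding SSYT_def by blast

lemma T_pos: "(i, j) \<in> diagram lam \<Longrightarrow> (i, j) \<notin> diagram mu \<Longrightarrow> 1 \<le> T i j"
proof -
  assume "(i, j) \<in> diagram lam" "(i, j) \<notin> diagram mu"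
  then have "T i j \<in> enat ` {1..2 * n}" using T unfolding SSYT_def by blast
  then show "1 \<le> T i j" by (auto simp: one_enat_def)
qed

lemma T_outside:
  assumes "T k c < enat r"
  shows "(k, c) \<in> diagram lam"
proof (rule ccontr)
  assume "(k, c) \<notin> diagram lam"
  then have "T k c = \<infinity>" using T unfolding SSYT_def by blast
  with assms show False by simp
qed

lemma T_left:
  assumes "T k c < enat r" "1 \<le> c'" "c' \<le> c"
  shows "T k c' < enat r"
  using assms(3,1)
proof (induction rule: inc_induct)
  case (step d)
  then have d: "T k (Suc d) < enat r" by simp
  then have "(k, Suc d) \<in> diagram lam" by (rule T_outside)
  moreover from this have "(k, d) \<in> diagram lam"
    using step.hyps assms(2) by (auto simp: diagram_def)
  ultimately have "T k d \<le> T k (Suc d)"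
    using T unfolding SSYT_def by blast
  with d show ?case by simp
qed

lemma T_row_set: "{c. T k c < enat r} = {1..card {c. T k c < enat r}}"
proof -
  define S where "S = {c. T k c < enat r}"
  have pos: "1 \<le> c" "c \<le> lam k" if "c \<in> S" for c
    using T_outside[of k c r] that by (auto simp: diagram_def S_def)
  then have "S \<subseteq> {1..lam k}" by auto
  then have fin: "finite S" by (rule finite_subset) simp
  have "S = {1..card S}"
  proof (cases "S = {}")
    case False
    then have M: "Max S \<in> S" using fin by simp
    have "S = {1..Max S}"
    proof (intro set_eqI iffI)
      fix c assume "c \<in> S"
      then show "c \<in> {1..Max S}" using pos fin by simp
    next
      fix c assume "c \<in> {1..Max S}"
      then show "c \<in> S" using T_left[of k "Max S" r c] M by (simp add: S_def)
    qed
    moreover from this have "card S = Max S" by (metis card_atLeastAtMost diff_Suc_1)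
    ultimately show ?thesis by simp
  qed simp
  then show ?thesis by (simp add: S_def)
qed

lemma companion_shape_diagram:
  "(a, b) \<in> diagram (companion_shape n T i) \<longleftrightarrow>
     1 \<le> a \<and> a \<le> i \<and> T (2 * n - i + a) b < enat (2 * n - i + 1)"
proof -
  have "T k b < enat r \<longleftrightarrow> 1 \<le> b \<and> b \<le> card {c. T k c < enat r}" for k r
    using T_row_set[of k r] by (metis atLeastAtMost_iff mem_Collect_eq)
  then show ?thesis
    unfolding diagram_def companion_shape_def Let_def by auto
qed

lemma companion_shape_top: "diagram (companion_shape n T (2 * n)) = diagram mu"
proof -
  have "(a, b) \<in> diagram (companion_shape n T (2 * n)) \<longleftrightarrow> (a, b) \<in> diagram mu" for a b
  proof
    assume "(a, b) \<in> diagram (companion_shape n T (2 * n))"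
    then have "T a b < enat 1" unfolding companion_shape_diagram by simp
    moreover from this have "(a, b) \<in> diagram lam" by (rule T_outside)
    ultimately show "(a, b) \<in> diagram mu" using T_pos[of a b] by (metis leD one_enat_def)
  next
    assume ab: "(a, b) \<in> diagram mu"
    then have "1 \<le> a" "a \<le> len mu" using partition_len[OF mu] by (auto simp: diagram_def)
    moreover have "T a b = 0" using T_mu[OF ab] .
    ultimately show "(a, b) \<in> diagram (companion_shape n T (2 * n))"
      unfolding companion_shape_diagram using lmu by (simp add: zero_enat_def)
  qed
  then show ?thesis by auto
qed

lemma companion_shape_Suc:
  assumes "Suc i \<le> 2 * n"
  shows "diagram (companion_shape n T i) \<subseteq> diagram (companion_shape n T (Suc i))"
proof (clarify, unfold companion_shape_diagram, elim conjE, intro conjI)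
  fix a b assume a: "1 \<le> a" "a \<le> i" and lt: "T (2 * n - i + a) b < enat (2 * n - i + 1)"
  show "1 \<le> a" "a \<le> Suc i" using a by auto
  define k where "k = 2 * n - Suc i + a"
  have k: "2 * n - i + a = Suc k" "1 \<le> k" using a assms by (auto simp: k_def)
  have D: "(Suc k, b) \<in> diagram lam" using T_outside lt unfolding k .
  then have D': "(k, b) \<in> diagram lam" using diagram_up[OF lam] k by blast
  show "T (2 * n - Suc i + a) b < enat (2 * n - Suc i + 1)"
  proof (cases "(k, b) \<in> diagram mu")
    case True
    then have "T k b = 0" by (rule T_mu)
    then show ?thesis by (simp add: k_def zero_enat_def)
  next
    case False
    then have "(Suc k, b) \<notin> diagram mu" using diagram_up[OF mu] k by blast
    then have "T k b < T (Suc k) b" using T D D' False unfolding SSYT_def by blast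
    moreover have "T (Suc k) b \<le> enat (2 * n - Suc i + 1)"
      using lt assms unfolding k by (cases "T (Suc k) b") auto
    ultimately show ?thesis by (simp add: k_def)
  qed
qed

lemma companion_shape_mono:
  assumes "i \<le> i'" "i' \<le> 2 * n"
  shows "diagram (companion_shape n T i) \<subseteq> diagram (companion_shape n T i')"
  using assms
proof (induction i' rule: dec_induct)
  case (step k)
  then show ?case using companion_shape_Suc[of k] by (meson Suc_leD subset_trans)
qed simp

lemma left_companion_le:
  assumes "(a, b) \<in> diagram mu" "i \<le> 2 * n"
  shows "left_companion n mu T a b \<le> enat i \<longleftrightarrow> (a, b) \<in> diagram (companion_shape n T i)"
proof -
  let ?P = "\<lambda>i. (a, b) \<in> diagram (companion_shape n T i)"
  have "?P (2 * n)" using assms companion_shape_top by simp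
  then have L: "?P (LEAST i. ?P i)" by (rule LeastI)
  show ?thesis
    using assms companion_shape_mono[OF _ assms(2)] L Least_le[of ?P i]
    unfolding left_companion_def by auto
qed

lemma left_companion_cells:
  assumes "i \<le> 2 * n"
  shows "{(a, b). left_companion n mu T a b \<le> enat i} = diagram (companion_shape n T i)"
proof -
  have "left_companion n mu T a b = \<infinity>" "(a, b) \<notin> diagram (companion_shape n T i)"
    if "(a, b) \<notin> diagram mu" for a b
    using that companion_shape_mono[OF assms] companion_shape_top
    by (auto simp: left_companion_def)
  then have "left_companion n mu T a b \<le> enat i
      \<longleftrightarrow> (a, b) \<in> diagram (companion_shape n T i)" for a b
    using left_companion_le[OF _ assms, of a b] by (cases "(a, b) \<in> diagram mu") simp_all
  then show ?thesis by auto
qed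

lemma left_companion_SST: "left_companion n mu T \<in> SST (2 * n) mu"
proof -
  let ?G = "left_companion n mu T"
  have ex: "\<exists>g. ?G a b = enat g \<and> 1 \<le> g \<and> g \<le> 2 * n" if ab: "(a, b) \<in> diagram mu" for a b
  proof -
    have "?G a b \<le> enat (2 * n)" using left_companion_le[OF ab] companion_shape_top ab by blast
    moreover have "\<not> ?G a b \<le> enat 0"
      using left_companion_le[OF ab, of 0] unfolding companion_shape_diagram by simp
    ultimately show ?thesis by (cases "?G a b") auto
  qed
  have row: "?G a b \<le> ?G a (Suc b)"
    if ab: "(a, b) \<in> diagram mu" and ab': "(a, Suc b) \<in> diagram mu" for a b
  proof -
    obtain g where g: "?G a (Suc b) = enat g" "g \<le> 2 * n" using ex[OF ab'] by blast
    then have "(a, Suc b) \<in> diagram (companion_shape n T g)"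
      using left_companion_le[OF ab', of g] by simp
    then have "(a, b) \<in> diagram (companion_shape n T g)"
      using ab by (auto simp: diagram_def)
    then show ?thesis using left_companion_le[OF ab] g by simp
  qed
  have col: "?G a b < ?G (Suc a) b"
    if ab: "(a, b) \<in> diagram mu" and ab': "(Suc a, b) \<in> diagram mu" for a b
  proof -
    obtain g where g: "?G (Suc a) b = enat g" "1 \<le> g" "g \<le> 2 * n" using ex[OF ab'] by blast
    then have "(Suc a, b) \<in> diagram (companion_shape n T g)"
      using left_companion_le[OF ab', of g] by simp
    then have *: "Suc a \<le> g" "T (2 * n - g + Suc a) b < enat (2 * n - g + 1)"
      unfolding companion_shape_diagram by auto
    have eq: "2 * n - (g - 1) + a = 2 * n - g + Suc a" using g by simp
    have "1 \<le> a" using ab by (auto simp: diagram_def)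
    moreover have "T (2 * n - g + Suc a) b < enat (2 * n - (g - 1) + 1)"
      by (rule less_le_trans[OF *(2)]) simp
    ultimately have "(a, b) \<in> diagram (companion_shape n T (g - 1))"
      unfolding companion_shape_diagram eq using * by simp
    then have "?G a b \<le> enat (g - 1)" using left_companion_le[OF ab] g by simp
    also have "\<dots> < enat g" using g by simp
    finally show ?thesis using g by simp
  qed
  have "diagram (\<lambda>_. 0) = {}" by (auto simp: diagram_def)
  moreover have "?G a b \<in> enat ` {1..2 * n}" if "(a, b) \<in> diagram mu" for a b
    using ex[OF that] by auto
  ultimately show ?thesis
    unfolding SST_def SSYT_def using row col by (auto simp: left_companion_def)
qed

end

end

theory Submission
  imports Defs
begin

text \<open>Everything takes place in the first column of \<open>T\<close>. If \<open>T(k,1) = 2i+1\<close>, then, since the weight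
  is even and the word is Yamanouchi, a letter \<open>2i+2\<close> must be read after this one, and by
  semistandardness it can only be at \<open>(k+1,1)\<close>. As long as there is no Sundaram violation,
  \<open>T(n+s,1) \<ge> 2s\<close> by induction on \<open>s\<close>; hence the first violation, in row \<open>n+t+1\<close>, forces
  \<open>T(n+t+1,1) = 2t+1\<close> and \<open>T(n+t+2,1) = 2t+2\<close>. On the other hand, a symplectic violation in row
  \<open>n-s\<close> of the left companion means precisely \<open>T(n+s+2,1) \<le> 2s+2\<close>. Row \<open>n-t\<close> is
  such a row, because strictness of the column gives \<open>2t+1 = T(n+t+1,1) \<ge> n+t+1-\<ell>(\<mu>)\<close>, that is
  \<open>n-t \<le> \<ell>(\<mu>)\<close>.\<close>

section \<open>Diagrams, reading words and weights\<close>

lemma diagram_first_column: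
  assumes "is_partition p"
  shows "(k, 1) \<in> diagram p \<longleftrightarrow> 1 \<le> k \<and> k \<le> len p"
proof
  assume "(k, 1) \<in> diagram p"
  then show "1 \<le> k \<and> k \<le> len p"
    using partition_len[OF assms, of k] by (auto simp: diagram_def)
next
  assume k: "1 \<le> k \<and> k \<le> len p"
  have "p k \<noteq> 0"
  proof
    assume 0: "p k = 0"
    \<comment> \<open>A zero part at \<open>k\<close> confines the nonzero parts to indices before
      \<open>k\<close>, so there are at most \<open>k - 1\<close> of them.\<close>
    have "{i. 1 \<le> i \<and> p i \<noteq> 0} \<subseteq> {1..<k}"
    proof
      fix i assume "i \<in> {i. 1 \<le> i \<and> p i \<noteq> 0}"
      then show "i \<in> {1..<k}"
        using partition_antimono[OF assms, of k i] k 0 by (cases "i < k") auto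
    qed
    then have "len p \<le> card {1..<k}" unfolding len_def by (intro card_mono) auto
    with k show False by simp linarith
  qed
  with k show "(k, 1) \<in> diagram p" by (simp add: diagram_def)
qed

definition row_word :: "(nat \<Rightarrow> nat) \<Rightarrow> (nat \<Rightarrow> nat \<Rightarrow> enat) \<Rightarrow> nat \<Rightarrow> nat list" where
  "row_word lam T i =
     map (\<lambda>j. the_enat (T i j)) (filter (\<lambda>j. T i j \<noteq> 0) (rev [1..<Suc (lam i)]))"

lemma reverse_row_word_rows:
  "reverse_row_word lam T = concat (map (row_word lam T) [1..<Suc (len lam)])"
  by (simp add: reverse_row_word_def row_word_def[abs_def])

lemma count_list_concat: "count_list (concat xss) a = (\<Sum>xs\<leftarrow>xss. count_list xs a)"
  by (induction xss) auto

lemma SSYT_finite: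
  assumes "T \<in> SSYT m lam mu" "(i, j) \<in> diagram lam"
  shows "\<exists>a. T i j = enat a"
proof (cases "(i, j) \<in> diagram mu")
  case True
  then have "T i j = 0" using assms unfolding SSYT_def by blast
  then show ?thesis by (auto simp: zero_enat_def)
next
  case False
  then have "T i j \<in> enat ` {1..m}" using assms unfolding SSYT_def by blast
  then show ?thesis by blast
qed

lemma SSYT_outside:
  assumes "T \<in> SSYT m lam mu" "T i j = enat a"
  shows "(i, j) \<in> diagram lam"
proof (rule ccontr)
  assume "(i, j) \<notin> diagram lam"
  then have "T i j = \<infinity>" using assms(1) unfolding SSYT_def by blast
  with assms(2) show False by simp
qed

lemma count_row_word:
  assumes T: "T \<in> SSYT m lam mu" and i: "1 \<le> i" and a: "1 \<le> a"
  shows "count_list (row_word lam T i) a = card {j. T i j = enat a}"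
proof -
  \<comment> \<open>The bound on \<open>j\<close> keeps the cell inside \<lambda>, where entries are
    finite; outside, \<open>the_enat\<close> would be applied to \<infinity>.\<close>
  have P: "T i j = enat a \<longleftrightarrow> (T i j \<noteq> 0 \<and> the_enat (T i j) = a) \<and> j \<in> {1..lam i}" for j
    using SSYT_finite[OF T, of i j] SSYT_outside[OF T, of i j a] i a
    by (auto simp: diagram_def zero_enat_def)
  have "count_list (row_word lam T i) a
      = length (filter (\<lambda>j. T i j \<noteq> 0 \<and> the_enat (T i j) = a) (rev [1..<Suc (lam i)]))"
    unfolding row_word_def count_list_eq_length_filter filter_map length_map filter_filter
    by (intro arg_cong[where f = length] filter_cong) auto
  also have "\<dots> = card ({j. T i j \<noteq> 0 \<and> the_enat (T i j) = a} \<inter> {1..lam i})"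
    by (subst distinct_length_filter) (auto intro!: arg_cong[where f = card])
  also have "{j. T i j \<noteq> 0 \<and> the_enat (T i j) = a} \<inter> {1..lam i} = {j. T i j = enat a}"
    unfolding P by blast
  finally show ?thesis .
qed

text \<open>All finite entries lie in rows \<open>1\<close> to \<open>len lam\<close>, so adding the
  row counts misses none. This turns evenness of the weight into equalities between letter counts of
  the word.\<close>

lemma count_reverse_row_word:
  assumes T: "T \<in> SSYT m lam mu" and lam: "is_partition lam" and a: "1 \<le> a"
  shows "count_list (reverse_row_word lam T) a = weight T a"
proof -
  have sub: "i \<in> {1..len lam} \<and> j \<in> {1..lam i}" if "T i j = enat a" for i j
    using SSYT_outside[OF T that] partition_len[OF lam, of i] by (auto simp: diagram_def)
  have fin: "finite {j. T i j = enat a}" for i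
    by (rule finite_subset[of _ "{1..lam i}"]) (use sub in auto)
  have "count_list (reverse_row_word lam T) a
      = (\<Sum>i\<leftarrow>[1..<Suc (len lam)]. count_list (row_word lam T i) a)"
    by (simp add: reverse_row_word_rows count_list_concat o_def)
  also have "\<dots> = (\<Sum>i\<in>{1..len lam}. count_list (row_word lam T i) a)"
    by (subst sum_list_distinct_conv_sum_set) (auto intro!: sum.cong)
  also have "\<dots> = (\<Sum>i\<in>{1..len lam}. card {j. T i j = enat a})"
    using count_row_word[OF T _ a] by (intro sum.cong) auto
  also have "\<dots> = card (SIGMA i:{1..len lam}. {j. T i j = enat a})"
    using fin by (subst card_SigmaI) auto
  also have "(SIGMA i:{1..len lam}. {j. T i j = enat a}) = {(i, j). T i j = enat a}"
    using sub by auto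
  finally show ?thesis by (simp add: weight_def)
qed

text \<open>Rows are read from right to left, so a nonzero entry of the first column is the last
  letter of its row.\<close>

lemma row_word_first_column:
  assumes "T k 1 = enat a" "a \<noteq> 0" "1 \<le> lam k"
  shows "\<exists>u. row_word lam T k = u @ [a]"
proof -
  have "[1..<Suc (lam k)] = 1 # [2..<Suc (lam k)]"
    using assms(3) by (simp add: upt_conv_Cons numeral_2_eq_2)
  then show ?thesis
    using assms(1,2) unfolding row_word_def by (simp add: zero_enat_def)
qed

lemma sundaram_iff: "sundaram_property n T \<longleftrightarrow> (\<forall>k. \<not> sundaram_violation n T k)"
  unfolding sundaram_property_def sundaram_violation_def by (meson not_le)

lemma symplectic_iff:
  "symplectic mu G \<longleftrightarrow> (\<forall>k. \<not> symplectic_violation mu G k)"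
  unfolding symplectic_def symplectic_violation_def by (meson not_le)

section \<open>The first column of an even Littlewood-Richardson tableau\<close>

context
  fixes n :: nat and lam mu nu :: "nat \<Rightarrow> nat" and T :: "nat \<Rightarrow> nat \<Rightarrow> enat"
  assumes lam: "is_partition lam" and llam: "len lam \<le> 2 * n"
    and mu: "is_partition mu" and lmu: "len mu \<le> n"
    and nu: "even_partition nu" and LR: "T \<in> LR n lam mu nu"
begin

lemma T_SSYT: "T \<in> SSYT (2 * n) lam mu"
  using LR by (simp add: LR_def)

lemma lmu2: "len mu \<le> 2 * n"
  using lmu by simp

text \<open>Below row \<open>len mu\<close> the column lies outside \<mu>: its first entry there is
  at least 1, and strictness adds at least 1 per row. Beneath the diagram, \<infinity> satisfies
  every bound.\<close>

lemma column_lower: "len mu < k \<Longrightarrow> enat (k - len mu) \<le> T k 1"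
proof (induction k)
  case (Suc k)
  show ?case
  proof (cases "(Suc k, 1) \<in> diagram lam")
    case False
    then have "T (Suc k) 1 = \<infinity>" using T_SSYT unfolding SSYT_def by blast
    then show ?thesis by simp
  next
    case True
    have out: "(Suc k, 1) \<notin> diagram mu"
      using Suc.prems diagram_first_column[OF mu] by simp
    show ?thesis
    proof (cases "k = len mu")
      case True
      then show ?thesis
        using T_pos[OF lam mu lmu2 T_SSYT \<open>(Suc k, 1) \<in> diagram lam\<close> out]
        by (simp add: one_enat_def)
    next
      case False
      then have k: "len mu < k" using Suc.prems by simp
      then have "(k, 1) \<in> diagram lam" "(k, 1) \<notin> diagram mu"
        using True diagram_first_column[OF lam] diagram_first_column[OF mu] by auto
      then have "T k 1 < T (Suc k) 1" using True out T_SSYT unfolding SSYT_def by blast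
      then have "enat (k - len mu) < T (Suc k) 1" using Suc.IH[OF k] by simp
      then show ?thesis using k by (cases "T (Suc k) 1") auto
    qed
  qed
qed simp

text \<open>The row \<open>k = len mu\<close> is included: there the step goes from the 0 in the
  last cell of \<mu> to a positive entry. Finiteness of the upper entry avoids comparing \<infinity>
  with itself.\<close>

lemma column_strict:
  assumes "len mu \<le> k" "1 \<le> k" "T k 1 < \<infinity>"
  shows "T k 1 < T (Suc k) 1"
proof (cases "(Suc k, 1) \<in> diagram lam")
  case False
  then have "T (Suc k) 1 = \<infinity>" using T_SSYT unfolding SSYT_def by blast
  then show ?thesis using assms by simp
next
  case lk: True
  have out: "(Suc k, 1) \<notin> diagram mu"
    using assms diagram_first_column[OF mu] by simp
  show ?thesis
  proof (cases "(k, 1) \<in> diagram mu")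
    case True
    then have "T k 1 = 0" by (rule T_mu[OF lam mu lmu2 T_SSYT])
    then show ?thesis
      using T_pos[OF lam mu lmu2 T_SSYT lk out] by (cases "T (Suc k) 1")
        (auto simp: one_enat_def zero_enat_def)
  next
    case False
    have "(k, 1) \<in> diagram lam" using lk diagram_up[OF lam] assms by blast
    then show ?thesis using False lk out T_SSYT unfolding SSYT_def by blast
  qed
qed

lemma first_column_least:
  assumes "T k j = enat a"
  shows "T k 1 \<le> enat a"
proof -
  have "1 \<le> j" using SSYT_outside[OF T_SSYT assms] by (simp add: diagram_def)
  \<comment> \<open>Rows pass strict bounds to the left, so the weak bound \<open>a\<close> travels
    as the strict bound \<open>Suc a\<close>.\<close>
  then have "T k 1 < enat (Suc a)"
    using T_left[OF lam mu lmu2 T_SSYT, of k j "Suc a" 1] assms by simp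
  then show ?thesis by (cases "T k 1") auto
qed

text \<open>The induction may run past the bottom of the diagram: \<lambda> is closed upwards, so
  the column stays at \<infinity> once it gets there.\<close>

lemma column_strict_far:
  assumes "len mu \<le> k" "1 \<le> k" "T k 1 = enat a"
  shows "enat (a + d) \<le> T (k + d) 1"
proof (induction d)
  case (Suc d)
  show ?case
  proof (cases "T (k + d) 1")
    case (enat b)
    then have "T (k + d) 1 < T (Suc (k + d)) 1" using assms by (intro column_strict) auto
    then show ?thesis using enat Suc by (cases "T (Suc (k + d)) 1") auto
  next
    case infinity
    have "(Suc (k + d), 1) \<notin> diagram lam"
    proof
      assume "(Suc (k + d), 1) \<in> diagram lam"
      then have "(k + d, 1) \<in> diagram lam" using diagram_up[OF lam] assms by simp
      then show False using SSYT_finite[OF T_SSYT] infinity by fastforce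
    qed
    then have "T (Suc (k + d)) 1 = \<infinity>" using T_SSYT unfolding SSYT_def by blast
    then show ?thesis by simp
  qed
qed (use assms in simp)

text \<open>The odd letter is the last one of its row, so any letter read after it lies in a lower
  row. Evenness and the Yamanouchi condition force a letter \<open>2 * i + 2\<close> among these,
  and the growth of the column leaves room for it only in the next row.\<close>

lemma odd_in_first_column:
  assumes odd: "T k 1 = enat (2 * i + 1)"
  shows "T (Suc k) 1 = enat (2 * i + 2)"
proof -
  let ?a = "2 * i + 1" and ?b = "2 * i + 2"
  let ?w = "reverse_row_word lam T" and ?R = "\<lambda>ks. concat (map (row_word lam T) ks)"
  have kD: "(k, 1) \<in> diagram lam" using SSYT_outside[OF T_SSYT odd] .
  then have k: "1 \<le> k" "k \<le> len lam" "1 \<le> lam k"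
    using diagram_first_column[OF lam] by (auto simp: diagram_def)
  have "(k, 1) \<notin> diagram mu"
    using odd T_mu[OF lam mu lmu2 T_SSYT, of k 1] by (auto simp: zero_enat_def)
  then have kmu: "len mu \<le> k" using k diagram_first_column[OF mu] by auto
  obtain u where u: "row_word lam T k = u @ [?a]"
    using row_word_first_column[of T k ?a] odd k by auto
  have "[1..<Suc (len lam)] = [1..<k] @ k # [Suc k..<Suc (len lam)]"
    using k upt_add_eq_append[of 1 k "Suc (len lam) - k"] upt_conv_Cons[of k "Suc (len lam)"] by simp
  then have w: "?w = (?R [1..<k] @ u) @ [?a] @ ?R [Suc k..<Suc (len lam)]"
    by (simp add: reverse_row_word_rows u)
  have cnt: "count_list ?w ?a = count_list ?w ?b"
  proof -
    have "nu (2 * Suc i - 1) = nu (2 * Suc i)"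
      using nu unfolding even_partition_def by (metis le_add1 plus_1_eq_Suc)
    then have "nu ?a = nu ?b" by simp
    moreover have "weight T ?a = nu ?a" "weight T ?b = nu ?b" using LR by (auto simp: LR_def)
    ultimately show ?thesis using count_reverse_row_word[OF T_SSYT lam] by simp
  qed
  have "prefix (?R [1..<k] @ u) ?w" by (subst w) (rule prefixI, rule refl)
  then have "is_partition (count_list (?R [1..<k] @ u))"
    using LR unfolding LR_def yamanouchi_def by blast
  then have "count_list (?R [1..<k] @ u) ?b \<le> count_list (?R [1..<k] @ u) ?a"
    unfolding is_partition_def by auto
  \<comment> \<open>The prefix stops just before the \<open>?a\<close> of row \<open>k\<close> and
    has at least as many \<open>?a\<close> as \<open>?b\<close>. That one further \<open>?a\<close>
    must be balanced by a \<open>?b\<close> in the rest, since the totals agree.\<close>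
  then have "count_list (?R [Suc k..<Suc (len lam)]) ?b \<noteq> 0"
    using cnt unfolding w by simp
  then have "?b \<in> set (?R [Suc k..<Suc (len lam)])" by (metis count_list_0_iff)
  then obtain k' where k': "k < k'" "?b \<in> set (row_word lam T k')"
    by (auto simp: Suc_le_eq simp del: upt_Suc)
  then obtain j where j: "1 \<le> j" "j \<le> lam k'" "the_enat (T k' j) = ?b"
    unfolding row_word_def by auto
  moreover have "\<exists>c. T k' j = enat c"
    using j k' by (intro SSYT_finite[OF T_SSYT]) (auto simp: diagram_def)
  ultimately have "T k' j = enat ?b" by auto
  then have le: "T k' 1 \<le> enat ?b" by (rule first_column_least)
  \<comment> \<open>Row \<open>k'\<close> starts with at least \<open>?a + (k' - k)\<close> and at
    most \<open>?b = ?a + 1\<close>, which leaves \<open>k' - k = 1\<close>.\<close>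
  have "enat (?a + (k' - k)) \<le> T (k + (k' - k)) 1"
    by (rule column_strict_far[OF kmu k(1) odd])
  then have ge: "enat (?a + (k' - k)) \<le> T k' 1" using k' by simp
  then have "enat (?a + (k' - k)) \<le> enat ?b" using le by (rule order_trans)
  then have "k' = Suc k" using k' by simp
  then show ?thesis using le ge by auto
qed

section \<open>Sundaram violations against symplectic violations\<close>

lemma column_bound:
  assumes n: "1 \<le> n" and none: "\<And>k. k \<le> n + t \<Longrightarrow> \<not> sundaram_violation n T k"
  shows "s \<le> t \<Longrightarrow> enat (2 * s) \<le> T (n + s) 1"
proof (induction s)
  case 0
  then show ?case by (simp add: zero_enat_def[symmetric])
next
  case (Suc s)
  then have IH: "enat (2 * s) \<le> T (n + s) 1" by simp
  show ?case
  proof (cases "T (n + Suc s) 1")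
    case (enat b)
    have D: "(Suc (n + s), 1) \<in> diagram lam" using SSYT_outside[OF T_SSYT enat] by simp
    then have "(n + s, 1) \<in> diagram lam" using diagram_up[OF lam] n by simp
    then have "T (n + s) 1 < \<infinity>" using SSYT_finite[OF T_SSYT] by fastforce
    then have "T (n + s) 1 < T (Suc (n + s)) 1" using lmu n by (intro column_strict) auto
    then have "enat (2 * s) < enat b"
      using IH enat by (metis add_Suc_right le_less_trans)
    \<comment> \<open>Strictness alone gives \<open>2 * s + 1\<close>; the missing unit comes from
      the fact that this odd letter in row \<open>n + s + 1\<close> would be a Sundaram
      violation.\<close>
    moreover have "b \<noteq> 2 * s + 1"
    proof
      assume "b = 2 * s + 1"
      then have "sundaram_violation n T (n + Suc s)"
        using enat unfolding sundaram_violation_def by (intro exI[of _ 1] exI[of _ s]) auto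
      with none[of "n + Suc s"] Suc.prems show False by simp
    qed
    ultimately show ?thesis using enat by simp
  qed simp
qed

text \<open>A violation puts the cell \<open>(n - s, 1)\<close> into the companion shape of index
  \<open>2 * (n - s) - 2\<close>. For this index \<open>r = 2 * s + 3\<close>, and the cell is
  tested in row \<open>r + (n - s) - 1 = n + s + 2\<close> of \<open>T\<close> by an entry below
  \<open>r\<close>.\<close>

lemma symplectic_violation_iff:
  assumes k: "s < n" "n - s \<le> len mu"
  shows "symplectic_violation mu (left_companion n mu T) (n - s) \<longleftrightarrow>
    T (n + s + 2) 1 \<le> enat (2 * s + 2)"
proof -
  let ?k = "n - s"
  have D: "(?k, 1) \<in> diagram mu" using k diagram_first_column[OF mu] by auto
  have "left_companion n mu T ?k 1 < enat (2 * ?k - 1) \<longleftrightarrow>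
      left_companion n mu T ?k 1 \<le> enat (2 * ?k - 2)"
    using k by (cases "left_companion n mu T ?k 1") auto
  also have "\<dots> \<longleftrightarrow> (?k, 1) \<in> diagram (companion_shape n T (2 * ?k - 2))"
    by (rule left_companion_le[OF lam mu lmu2 T_SSYT D]) simp
  also have "\<dots> \<longleftrightarrow> 1 \<le> ?k \<and> ?k \<le> 2 * ?k - 2 \<and>
      T (2 * n - (2 * ?k - 2) + ?k) 1 < enat (2 * n - (2 * ?k - 2) + 1)"
    by (rule companion_shape_diagram[OF lam mu lmu2 T_SSYT])
  also have "2 * n - (2 * ?k - 2) + ?k = n + s + 2" using k by simp
  also have "2 * n - (2 * ?k - 2) + 1 = 2 * s + 3" using k by simp
  also have "T (n + s + 2) 1 < enat (2 * s + 3) \<longleftrightarrow> T (n + s + 2) 1 \<le> enat (2 * s + 2)"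
    by (cases "T (n + s + 2) 1") auto
  also have "1 \<le> ?k \<and> ?k \<le> 2 * ?k - 2 \<and> T (n + s + 2) 1 \<le> enat (2 * s + 2) \<longleftrightarrow>
      T (n + s + 2) 1 \<le> enat (2 * s + 2)"
  proof -
    \<comment> \<open>A shape of index \<open>i\<close> has at most \<open>i\<close> rows, which
      here asks for \<open>s + 2 \<le> n\<close>. A finite entry in row \<open>n + s + 2\<close>
      provides it, as \<lambda> has at most \<open>2 * n\<close> rows.\<close>
    have "s + 2 \<le> n" if le: "T (n + s + 2) 1 \<le> enat (2 * s + 2)"
    proof -
      obtain c where "T (n + s + 2) 1 = enat c" using le by (cases "T (n + s + 2) 1") auto
      then have "n + s + 2 \<le> len lam"
        using SSYT_outside[OF T_SSYT] diagram_first_column[OF lam] by blast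
      then show ?thesis using llam by simp
    qed
    then show ?thesis by auto
  qed
  finally show ?thesis using k unfolding symplectic_violation_def by auto
qed

text \<open>The violating letter may stand anywhere in its row, but it bounds the first entry there
  by \<open>2 * t + 1\<close>. The lower bound \<open>2 * t\<close> one row above and strictness
  then pin both entries.\<close>

lemma first_sundaram_violation:
  assumes viol: "sundaram_violation n T (n + t + 1)"
    and min: "\<And>k. sundaram_violation n T k \<Longrightarrow> n + t + 1 \<le> k"
  shows "T (n + t) 1 = enat (2 * t)" "T (n + t + 1) 1 = enat (2 * t + 1)"
    "T (n + t + 2) 1 = enat (2 * (t + 1))"
    "k \<le> t \<Longrightarrow> enat (2 * k) \<le> T (n + k) 1"
    "n - len mu \<le> t" "t < n"
proof -
  obtain j i where ji: "T (n + t + 1) j = enat (2 * i + 1)" "i \<le> t"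
    using viol unfolding sundaram_violation_def by auto
  have "T (n + t + 1) 1 \<le> enat (2 * i + 1)" by (rule first_column_least[OF ji(1)])
  then obtain b where b: "T (n + t + 1) 1 = enat b" "b \<le> 2 * t + 1"
    using ji(2) by (cases "T (n + t + 1) 1") auto
  have D: "(Suc (n + t), 1) \<in> diagram lam" using SSYT_outside[OF T_SSYT b(1)] by simp
  then have n: "1 \<le> n" using diagram_first_column[OF lam] llam by simp
  have none: "\<not> sundaram_violation n T k" if "k \<le> n + t" for k
    using min[of k] that by auto
  show lower: "enat (2 * k) \<le> T (n + k) 1" if "k \<le> t" for k
    by (rule column_bound[OF n none that])
  have "(n + t, 1) \<in> diagram lam" using D diagram_up[OF lam] n by simp
  then obtain c where c: "T (n + t) 1 = enat c" using SSYT_finite[OF T_SSYT] by blast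
  then have "T (n + t) 1 < T (Suc (n + t)) 1" using lmu n by (intro column_strict) auto
  then have "c < b" using b c by simp
  moreover have "2 * t \<le> c" using lower[of t] c by simp
  ultimately have bc: "b = 2 * t + 1" "c = 2 * t" using b by auto
  then show "T (n + t) 1 = enat (2 * t)" "T (n + t + 1) 1 = enat (2 * t + 1)"
    using b c by auto
  then show finite: "T (n + t + 2) 1 = enat (2 * (t + 1))"
    using odd_in_first_column[of "n + t + 1" t] by simp
  have "enat (n + t + 1 - len mu) \<le> T (n + t + 1) 1" using lmu by (intro column_lower) simp
  then show "n - len mu \<le> t" using b bc by simp
  have "n + t + 2 \<le> len lam"
    using SSYT_outside[OF T_SSYT finite] diagram_first_column[OF lam] by blast
  then show "t < n" using llam by simp
qed

lemma sundaram_imp_symplectic: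
  assumes "sundaram_property n T"
  shows "symplectic mu (left_companion n mu T)"
  unfolding symplectic_iff
proof (intro allI notI)
  fix k assume v: "symplectic_violation mu (left_companion n mu T) k"
  then have k: "1 \<le> k" "k \<le> len mu" unfolding symplectic_violation_def by auto
  define s where "s = n - k"
  have s: "k = n - s" "s < n" using k lmu by (auto simp: s_def)
  have "T (n + s + 2) 1 \<le> enat (2 * s + 2)"
    using v symplectic_violation_iff[of s] s k by auto
  \<comment> \<open>Without Sundaram violations the column bound reaches every row; in row
    \<open>n + s + 2\<close> it exceeds by 2 what a symplectic violation allows.\<close>
  moreover have "enat (2 * (s + 2)) \<le> T (n + (s + 2)) 1"
    using assms s by (intro column_bound[of "s + 2"]) (auto simp: sundaram_iff)
  ultimately have "enat (2 * (s + 2)) \<le> enat (2 * s + 2)"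
    by (metis add.assoc order_trans)
  then show False by simp
qed

text \<open>The entry \<open>2 * (t + 1)\<close> in row \<open>n + t + 2\<close> meets the criterion
  for row \<open>n - t\<close> with equality. Hence the largest violating row \<open>K\<close> is at
  least \<open>n - t\<close>, and \<open>len mu \<le> n\<close> gives
  \<open>len mu - K \<le> t\<close>.\<close>

lemma largest_symplectic_violation:
  assumes viol: "sundaram_violation n T (n + t + 1)"
    and min: "\<And>k. sundaram_violation n T k \<Longrightarrow> n + t + 1 \<le> k"
  shows "\<exists>K. symplectic_violation mu (left_companion n mu T) K \<and>
    (\<forall>k. symplectic_violation mu (left_companion n mu T) k \<longrightarrow> k \<le> K) \<and>
    (\<exists>s\<le>t. K + s = len mu)"
proof -
  let ?V = "symplectic_violation mu (left_companion n mu T)"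
  note t = first_sundaram_violation[OF viol min]
  have V: "?V (n - t)"
    using t(3,5,6) by (subst symplectic_violation_iff) auto
  have bound: "k \<le> len mu" if "?V k" for k
    using that unfolding symplectic_violation_def by simp
  define K where "K = (GREATEST k. ?V k)"
  have K: "?V K" unfolding K_def using V bound by (rule GreatestI_nat)
  have Kmax: "k \<le> K" if "?V k" for k
    unfolding K_def using that bound by (rule Greatest_le_nat)
  have "K + (len mu - K) = len mu" "len mu - K \<le> t"
    using bound[OF K] Kmax[OF V] lmu by auto
  with K Kmax show ?thesis by blast
qed

end

theorem theorem1:
  fixes n :: nat and lam mu nu :: "nat \<Rightarrow> nat" and T :: "nat \<Rightarrow> nat \<Rightarrow> enat"
  assumes "is_partition lam" and "len lam \<le> 2 * n"
    and "is_partition mu" and "diagram mu \<subseteq> diagram lam" and "len mu \<le> n"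
    and "is_partition nu" and "diagram nu \<subseteq> diagram lam" and "even_partition nu"
    and "T \<in> LR n lam mu nu"
  shows "(\<not> sundaram_property n T \<longleftrightarrow> \<not> symplectic mu (left_companion n mu T)) \<and>
    (\<not> sundaram_property n T \<longrightarrow>
      (\<exists>!t.
        (sundaram_violation n T (n + t + 1) \<and>
          (\<forall>k. sundaram_violation n T k \<longrightarrow> n + t + 1 \<le> k)) \<and>
        (T (n + t) 1 = enat (2 * t) \<and>
          T (n + t + 1) 1 = enat (2 * t + 1) \<and>
          T (n + t + 2) 1 = enat (2 * (t + 1)) \<and>
          (\<forall>k. 1 \<le> k \<and> k + 1 \<le> t \<longrightarrow> enat (2 * k) \<le> T (n + k) 1)) \<and>
        (\<exists>K. symplectic_violation mu (left_companion n mu T) K \<and>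
          (\<forall>k. symplectic_violation mu (left_companion n mu T) k \<longrightarrow> k \<le> K) \<and>
          (\<exists>s\<le>t. K + s = len mu))))"
proof -
  note ctx = assms(1,2,3,5,8,9)
  have least: "\<exists>t. sundaram_violation n T (n + t + 1) \<and>
      (\<forall>k. sundaram_violation n T k \<longrightarrow> n + t + 1 \<le> k)" if not: "\<not> sundaram_property n T"
  proof -
    define k0 where "k0 = (LEAST k. sundaram_violation n T k)"
    obtain k where "sundaram_violation n T k" using not by (auto simp: sundaram_iff)
    then have k0: "sundaram_violation n T k0" unfolding k0_def by (rule LeastI)
    \<comment> \<open>Every violating row exceeds \<open>n\<close>, so the truncated subtraction is
      exact.\<close>
    then have "k0 = n + (k0 - n - 1) + 1" unfolding sundaram_violation_def by auto
    then show ?thesis using k0 Least_le[of "sundaram_violation n T"] by (metis k0_def)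
  qed
  show ?thesis
  proof (intro conjI impI)
    show "\<not> sundaram_property n T \<longleftrightarrow> \<not> symplectic mu (left_companion n mu T)"
      using sundaram_imp_symplectic[OF ctx] least largest_symplectic_violation[OF ctx]
      unfolding symplectic_iff by metis
  next
    assume "\<not> sundaram_property n T"
    then obtain t where t: "sundaram_violation n T (n + t + 1)"
      "\<And>k. sundaram_violation n T k \<Longrightarrow> n + t + 1 \<le> k" using least by blast
    show "\<exists>!t.
        (sundaram_violation n T (n + t + 1) \<and>
          (\<forall>k. sundaram_violation n T k \<longrightarrow> n + t + 1 \<le> k)) \<and>
        (T (n + t) 1 = enat (2 * t) \<and>
          T (n + t + 1) 1 = enat (2 * t + 1) \<and>
          T (n + t + 2) 1 = enat (2 * (t + 1)) \<and>
          (\<forall>k. 1 \<le> k \<and> k + 1 \<le> t \<longrightarrow> enat (2 * k) \<le> T (n + k) 1)) \<and>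
        (\<exists>K. symplectic_violation mu (left_companion n mu T) K \<and>
          (\<forall>k. symplectic_violation mu (left_companion n mu T) k \<longrightarrow> k \<le> K) \<and>
          (\<exists>s\<le>t. K + s = len mu))"
      (is "\<exists>!t. ?P t")
    proof (rule ex1I[of _ t], intro conjI)
      show "\<forall>k. 1 \<le> k \<and> k + 1 \<le> t \<longrightarrow> enat (2 * k) \<le> T (n + k) 1"
        using first_sundaram_violation(4)[OF ctx t] by simp
    next
      fix t' assume *: "?P t'"
      \<comment> \<open>Both \<open>n + t + 1\<close> and \<open>n + t' + 1\<close> are the least
        violating row.\<close>
      have "n + t' + 1 \<le> n + t + 1" using * t(1) by blast
      moreover have "n + t + 1 \<le> n + t' + 1" using * t(2) by blast
      ultimately show "t' = t" by simp
    qed (use t first_sundaram_violation[OF ctx t] largest_symplectic_violation[OF ctx t] in auto)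
  qed
qed

end
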